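(* Let $V$ be a source component. If $A\in\mathsf{Exploit}^{\mathcal{A}}(V)$, then there exists a property $\mathbb{B}\subseteq\mathcal{B}^S$ such that $B(A[{\downarrow}V])\notin{\downarrow}\mathbb{B}$ but $B(C[V])\in\mathbb{B}$ for all source contexts $C$.
   Context: There are two languages, a source language and a target language. Each has whole programs, components, contexts, and a set of behaviors ($\mathcal{B}^S$ for the source, $\mathcal{B}^T$ for the target). Linking a context $C$ with a component $U$ of the same language gives a whole program $C[U]$ (assumed always well-defined). Each whole program $P$ has a behavior $B(P)$, in $\mathcal{B}^S$ or $\mathcal{B}^T$ according to its language. A compiler ${\downarrow}$ maps source whole programs, components and contexts to target whole programs, components and contexts respectively, and is modular: $B({\downarrow}(C[U]))=B({\downarrow}C[{\downarrow}U])$ for all source contexts $C$ and source components $U$. An arbitrary relation $\mapsto$ between $\mathcal{B}^S$ and $\mathcal{B}^T$ is given. A set $\mathcal{A}$ of target contexts (the attackers) is fixed. For a source component $V$, $$\mathsf{Exploit}^{\mathcal{A}}(V)=\{A\in\mathcal{A}\mid \text{there is no source context } C \text{ with } B(C[V])\mapsto B(A[{\downarrow}V])\}.$$ For $\mathbb{B}\subseteq\mathcal{B}^S$, $${\downarrow}\mathbb{B}=\{b^T\in\mathcal{B}^T\mid \exists\, b^S\in\mathbb{B},\ b^S\mapsto b^T\}.$$ *)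

theory Defs
  imports Main
begin

record ('p, 'u, 'c, 'b) lang =
  programs :: "'p set"
  components :: "'u set"
  contexts :: "'c set"
  behaviors :: "'b set"
  link :: "'c \<Rightarrow> 'u \<Rightarrow> 'p"
  beh :: "'p \<Rightarrow> 'b"

locale language =
  fixes L :: "('p, 'u, 'c, 'b) lang"
  assumes link_closed: "\<lbrakk>C \<in> contexts L; U \<in> components L\<rbrakk> \<Longrightarrow> link L C U \<in> programs L"
    and beh_closed: "P \<in> programs L \<Longrightarrow> beh L P \<in> behaviors L"

record ('p, 'u, 'c, 'q, 'v, 'd) compilation =
  compile_prog :: "'p \<Rightarrow> 'q"
  compile_comp :: "'u \<Rightarrow> 'v"
  compile_ctx :: "'c \<Rightarrow> 'd"

locale modular_compiler = source: language S + target: language T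
  for S :: "('p, 'u, 'c, 'b) lang" and T :: "('q, 'v, 'd, 'e) lang" +
  fixes K :: "('p, 'u, 'c, 'q, 'v, 'd) compilation"
  assumes compile_prog_closed: "P \<in> programs S \<Longrightarrow> compile_prog K P \<in> programs T"
    and compile_comp_closed: "U \<in> components S \<Longrightarrow> compile_comp K U \<in> components T"
    and compile_ctx_closed: "C \<in> contexts S \<Longrightarrow> compile_ctx K C \<in> contexts T"
    and modular: "\<lbrakk>C \<in> contexts S; U \<in> components S\<rbrakk> \<Longrightarrow>
      beh T (compile_prog K (link S C U)) = beh T (link T (compile_ctx K C) (compile_comp K U))"

definition exploit ::
  "('p, 'u, 'c, 'b) lang \<Rightarrow> ('q, 'v, 'd, 'e) lang \<Rightarrow> ('p, 'u, 'c, 'q, 'v, 'd) compilation \<Rightarrow>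
    ('b \<times> 'e) set \<Rightarrow> 'd set \<Rightarrow> 'u \<Rightarrow> 'd set" where
  "exploit S T K R \<A> V =
    {A \<in> \<A>. \<not> (\<exists>C \<in> contexts S. (beh S (link S C V), beh T (link T A (compile_comp K V))) \<in> R)}"

definition compile_property ::
  "('q, 'v, 'd, 'e) lang \<Rightarrow> ('b \<times> 'e) set \<Rightarrow> 'b set \<Rightarrow> 'e set" where
  "compile_property T R \<B> = {bT \<in> behaviors T. \<exists>bS \<in> \<B>. (bS, bT) \<in> R}"

end

theory Submission
  imports Defs
begin

text \<open>The strongest property that \<open>V\<close> satisfies in every source context is the
  set of behaviors it exhibits across those contexts. \<open>compile_property\<close> is monotone in
  the property, so this least choice is the one most likely to exclude the attack, and it
  does.\<close>

theorem mainTheorem4: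
  fixes S :: "('p, 'u, 'c, 'b) lang"
    and T :: "('q, 'v, 'd, 'e) lang"
    and K :: "('p, 'u, 'c, 'q, 'v, 'd) compilation"
    and R :: "('b \<times> 'e) set"
    and \<A> :: "'d set"
    and V :: 'u and A :: 'd
  assumes "modular_compiler S T K"
    and "R \<subseteq> behaviors S \<times> behaviors T"
    and "\<A> \<subseteq> contexts T"
    and "V \<in> components S"
    and "A \<in> exploit S T K R \<A> V"
  shows "\<exists>\<B>. \<B> \<subseteq> behaviors S \<and>
    beh T (link T A (compile_comp K V)) \<notin> compile_property T R \<B> \<and>
    (\<forall>C \<in> contexts S. beh S (link S C V) \<in> \<B>)"
proof (intro exI conjI ballI)
  let ?\<B> = "(\<lambda>C. beh S (link S C V)) ` contexts S"
  interpret modular_compiler S T K by fact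
  show "?\<B> \<subseteq> behaviors S"
    using \<open>V \<in> components S\<close> by (auto intro: source.beh_closed source.link_closed)
  \<comment> \<open>Every element of \<open>?\<B>\<close> comes from a source context linked with
    \<open>V\<close>, so membership would yield a context whose behavior is related by
    \<open>R\<close> to that of the attack, which is what \<open>exploit\<close> rules out.\<close>
  show "beh T (link T A (compile_comp K V)) \<notin> compile_property T R ?\<B>"
    using \<open>A \<in> exploit S T K R \<A> V\<close> by (auto simp: exploit_def compile_property_def)
  show "beh S (link S C V) \<in> ?\<B>" if "C \<in> contexts S" for C
    using that by (rule imageI)
qed

end
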